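(* Let $n\ge p$ be positive integers, let $\mathbb{E}$ be a finite-dimensional Euclidean space, let $\mathcal{A}:\mathbb{R}^{n\times p}\to\mathbb{E}$ be linear and $b\in\mathbb{E}$. Let $\bar X\in\mathbb{R}^{n\times p}$ with $\mathcal{A}(\bar X)=b$, $r:=\operatorname{rank}\bar X$, and singular value decomposition $\bar X=\bar U\operatorname{diag}(\sigma(\bar X))\bar V^T$, $\bar U\in O(n)$, $\bar V\in O(p)$, and set $$W(\bar X):=\left\{\bar U M\begin{pmatrix}I_r&0\\0&R\end{pmatrix}\bar V^T\ :\ M\in\mathbb{S}^n_+-\mathcal{S}^r_{++},\ \operatorname{tr}(M)=0,\ R\in\mathcal{V}_{n-r,p-r},\ M\begin{pmatrix}I_r&0\\0&RR^T\end{pmatrix}=M\right\}.$$ If (i) $\operatorname{ri}(\partial\|\cdot\|_*(\bar X))\cap\operatorname{rge}\mathcal{A}^*\neq\emptyset$ and (ii) $\operatorname{par}(\partial\|\cdot\|_*(\bar X))+\operatorname{rge}\mathcal{A}^*=\mathbb{R}^{n\times p}$, then $\ker\mathcal{A}\cap W(\bar X)=\{0\}$.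
   Context: $\mathbb{R}^{n\times p}$ carries the inner product $\langle X,Y\rangle=\operatorname{tr}(X^TY)$; $\mathcal{A}^*$ is the adjoint of $\mathcal{A}$ and $\operatorname{rge}\mathcal{A}^*$ its range. $\|\cdot\|_*$ is the nuclear norm (sum of singular values). $\partial\|\cdot\|_*(\bar X)=\{Y: \|\bar X\|_*+\langle Y,X-\bar X\rangle\le \|X\|_*\ \forall X\}$ is the convex subdifferential. For a nonempty convex set $C$, $\operatorname{ri}C$ is its relative interior and $\operatorname{par}C=\operatorname{aff}C-x$ (any $x\in C$) is the subspace parallel to $C$. $\sigma(\bar X)\in\mathbb{R}^p$ is the vector of singular values in nonincreasing order and $\operatorname{diag}(\sigma(\bar X))$ is the $n\times p$ rectangular diagonal matrix with these diagonal entries. $O(k)$ is the set of orthogonal $k\times k$ matrices; $\mathbb{S}^n_+$ the positive semidefinite symmetric $n\times n$ matrices; $\mathbb{S}^r_{++}$ the positive definite symmetric $r\times r$ matrices. $\mathcal{S}^r_{++}:=\left\{\begin{pmatrix}A&0\\0&0\end{pmatrix}\in\mathbb{S}^n_+: A\in\mathbb{S}^r_{++}\right\}$, and $\mathbb{S}^n_+-\mathcal{S}^r_{++}=\{P-S:P\in\mathbb{S}^n_+,S\in\mathcal{S}^r_{++}\}$. $\mathcal{V}_{m,q}=\{R\in\mathbb{R}^{m\times q}:R^TR=I_q\}$ is the Stiefel manifold. Blocks with zero rows or columns are void: if $r=p$ then $\mathcal{V}_{n-r,0}$ consists of the empty matrix and $RR^T=0\in\mathbb{R}^{(n-r)\times(n-r)}$;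 if $r=0$ then $\mathcal{S}^0_{++}=\{0\}$. *)

theory Defs
  imports
    "HOL-Analysis.Analysis"
    "Jordan_Normal_Form.Char_Poly"
begin

no_notation Matrix.vec_index (infixl \<open>$\<close> 100)
no_notation Matrix.scalar_prod (infix \<open>\<bullet>\<close> 70)
hide_const (open) Matrix.vec Matrix.mat Matrix.row Matrix.rows Determinant.det

text \<open>
  The ambient space of n by p matrices is the Euclidean space \<^typ>\<open>real^'p^'n\<close>, where n and p are
  the cardinalities of the linearly ordered index types. Blocks whose sizes depend on the rank
  cannot be typed this way; they are matrices with a carrier, of type \<^typ>\<open>real Matrix.mat\<close>, and
  are moved to the ambient space along the increasing enumeration of the index types.
\<close>

definition pos :: "'a::{finite,linorder} \<Rightarrow> nat" where
  "pos i = card {..<i}"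

definition to_hma :: "real Matrix.mat \<Rightarrow> real^'p::{finite,linorder}^'n::{finite,linorder}" where
  "to_hma B = (\<chi> i j. B $$ (pos i, pos j))"

definition of_hma :: "real^'p::{finite,linorder}^'n::{finite,linorder} \<Rightarrow> real Matrix.mat" where
  "of_hma X = Matrix.mat CARD('n) CARD('p) (\<lambda>(i, j). X $ inv_into UNIV pos i $ inv_into UNIV pos j)"

lemma pos_less_iff: "pos i < pos j \<longleftrightarrow> i < j"
proof -
  have mono: "pos a < pos b" if "a < b" for a b :: 'a
    unfolding pos_def using that by (intro psubset_card_mono) (auto intro: less_trans)
  then show ?thesis
    by (metis less_asym linorder_neqE)
qed

lemma inj_pos: "inj pos"
  by (rule injI) (metis linorder_neqE pos_less_iff less_irrefl)

lemma bij_betw_pos: "bij_betw pos (UNIV :: 'a::{finite,linorder} set) {..<CARD('a)}"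
proof -
  have "pos i < CARD('a)" for i :: 'a
    unfolding pos_def by (rule psubset_card_mono) auto
  then have "range (pos :: 'a \<Rightarrow> nat) \<subseteq> {..<CARD('a)}"
    by auto
  moreover have "card (range (pos :: 'a \<Rightarrow> nat)) = card {..<CARD('a)}"
    by (simp add: card_image inj_pos)
  ultimately show ?thesis
    by (simp add: bij_betw_def inj_pos card_subset_eq)
qed

lemma pos_less_card: "pos (i :: 'a::{finite,linorder}) < CARD('a)"
  using bij_betw_apply[OF bij_betw_pos, of i] by simp

lemma to_hma_of_hma: "to_hma (of_hma X) = X"
  by (simp add: to_hma_def of_hma_def vec_eq_iff inv_f_f[OF inj_pos] pos_less_card)

lemma inner_eq_trace: "X \<bullet> Y = trace (transpose X ** Y)" for X Y :: "real^'p^'n"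
  unfolding inner_vec_def trace_def matrix_matrix_mult_def transpose_def
  by (simp, rule sum.swap)

text \<open>
  The singular values are the square roots of the eigenvalues of the transpose of \<open>X\<close> times \<open>X\<close>.
  That matrix is symmetric positive semidefinite, so its characteristic polynomial has p
  nonnegative real roots, counted with multiplicity, and the list has length p.
\<close>

definition singular_values :: "real^'p::{finite,linorder}^'n::{finite,linorder} \<Rightarrow> real list" where
  "singular_values X =
     rev (sorted_list_of_multiset
       (image_mset sqrt (proots (char_poly (of_hma (transpose X ** X))))))"

definition nuclear_norm :: "real^'p::{finite,linorder}^'n::{finite,linorder} \<Rightarrow> real" where
  "nuclear_norm X = sum_list (singular_values X)"

definition rect_diag :: "real list \<Rightarrow> real^'p::{finite,linorder}^'n::{finite,linorder}" where
  "rect_diag s = (\<chi> i j. if pos i = pos j then s ! pos j else 0)"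

definition subdifferential :: "('a::real_inner \<Rightarrow> real) \<Rightarrow> 'a \<Rightarrow> 'a set" where
  "subdifferential f x = {y. \<forall>z. f x + y \<bullet> (z - x) \<le> f z}"

text \<open>
  For nonempty \<open>C\<close> the translate of the affine hull by \<open>- x\<close> does not depend on the choice of
  \<open>x \<in> C\<close>, so the union over all \<open>x\<close> taken here is that subspace.
\<close>

definition par :: "'a::real_vector set \<Rightarrow> 'a set" where
  "par C = {y - x |y x. y \<in> affine hull C \<and> x \<in> C}"

definition psd_mats :: "(real^'n^'n) set" where
  "psd_mats = {P. transpose P = P \<and> (\<forall>x. 0 \<le> x \<bullet> (P *v x))}"

definition pd_mats :: "nat \<Rightarrow> real Matrix.mat set" where
  "pd_mats r = {A \<in> carrier_mat r r. transpose_mat A = A \<and>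
     (\<forall>x \<in> carrier_vec r. x \<noteq> 0\<^sub>v r \<longrightarrow> 0 < scalar_prod x (A *\<^sub>v x))}"

definition pd_block_mats :: "nat \<Rightarrow> (real^'n::{finite,linorder}^'n::{finite,linorder}) set" where
  "pd_block_mats r =
     {S \<in> psd_mats. \<exists>A \<in> pd_mats r.
        S = to_hma (four_block_mat A (0\<^sub>m r (CARD('n) - r))
                                   (0\<^sub>m (CARD('n) - r) r) (0\<^sub>m (CARD('n) - r) (CARD('n) - r)))}"

definition stiefel :: "nat \<Rightarrow> nat \<Rightarrow> real Matrix.mat set" where
  "stiefel m q = {R \<in> carrier_mat m q. transpose_mat R * R = 1\<^sub>m q}"

definition id_block :: "nat \<Rightarrow> real Matrix.mat \<Rightarrow> real^'p::{finite,linorder}^'n::{finite,linorder}" where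
  "id_block r B = to_hma (four_block_mat (1\<^sub>m r) (0\<^sub>m r (dim_col B)) (0\<^sub>m (dim_row B) r) B)"

definition W_set ::
  "real^'n::{finite,linorder}^'n::{finite,linorder} \<Rightarrow> real^'p::{finite,linorder}^'p::{finite,linorder} \<Rightarrow>
   real^'p::{finite,linorder}^'n::{finite,linorder} \<Rightarrow> (real^'p::{finite,linorder}^'n::{finite,linorder}) set" where
  "W_set U V X =
     {U ** M ** id_block (rank X) R ** transpose V |M R.
        M \<in> {P - S |P S. P \<in> psd_mats \<and> S \<in> pd_block_mats (rank X)} \<and>
        trace M = 0 \<and>
        R \<in> stiefel (CARD('n) - rank X) (CARD('p) - rank X) \<and>
        M ** id_block (rank X) (R * transpose_mat R) = M}"

end

theory Submission
  imports Defs "Jordan_Normal_Form.Schur_Decomposition"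
begin

text \<open>
  Write \<open>X = U \<Sigma> D V\<^sup>T\<close> and \<open>Z = U M D V\<^sup>T \<in> W\<close>, where \<open>\<Sigma>\<close> is the square diagonal matrix of
  the singular values and \<open>D\<close> is the block matrix of \<open>I\<^sub>r\<close> and \<open>R\<close>. For small \<open>c > 0\<close> the matrix
  \<open>N = \<Sigma> + c M = (\<Sigma> - c S) + c P\<close> is positive semidefinite, because \<open>S\<close> lives on the block where
  \<open>\<Sigma>\<close> is positive definite. Together with \<open>N D D\<^sup>T = N\<close> this gives \<open>\<parallel>X + c Z\<parallel>\<^sub>* = tr N = tr \<Sigma> = \<parallel>X\<parallel>\<^sub>*\<close>.
  Hence every subgradient \<open>Y\<close> at \<open>X\<close> satisfies \<open>\<langle>Y, Z\<rangle> \<le> 0\<close>, and no explicit description of the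
  subdifferential is needed. If \<open>A Z = 0\<close>, the subgradient in (i) has inner product 0 with \<open>Z\<close>; as
  it lies in the relative interior, \<open>\<langle>\<cdot>, Z\<rangle>\<close> vanishes on the whole subdifferential. So \<open>Z\<close> is
  orthogonal to both summands in (ii), hence \<open>Z = 0\<close>.
\<close>

no_notation Matrix.vec_index (infixl \<open>$\<close> 100)
no_notation Matrix.scalar_prod (infix \<open>\<bullet>\<close> 70)
hide_const (open) Matrix.vec Matrix.mat Matrix.row Matrix.rows Determinant.det Matrix.orthogonal

section \<open>Transfer between the two matrix types\<close>

lemma sum_over_pos: "(\<Sum>i\<in>(UNIV :: 'a::{finite,linorder} set). f (pos i)) = (\<Sum>k=0..<CARD('a). f k)"
  using sum.reindex_bij_betw[OF bij_betw_pos, of f] by (simp add: atLeast0LessThan)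

lemma of_hma_carrier [simp]:
  "of_hma (X :: real^'p::{finite,linorder}^'n::{finite,linorder}) \<in> carrier_mat CARD('n) CARD('p)"
  by (simp add: of_hma_def)

lemma dim_of_hma [simp]:
  "dim_row (of_hma (X :: real^'p::{finite,linorder}^'n::{finite,linorder})) = CARD('n)"
  "dim_col (of_hma X) = CARD('p)"
  by (simp_all add: of_hma_def)

lemma of_hma_index [simp]: "of_hma X $$ (pos i, pos j) = X $ i $ j"
  by (simp add: of_hma_def inv_f_f[OF inj_pos] pos_less_card)

lemma ex_pos: "k < CARD('a) \<Longrightarrow> \<exists>i :: 'a::{finite,linorder}. k = pos i"
  using bij_betw_pos[where 'a='a] unfolding bij_betw_def by auto

lemma of_hma_eqI:
  assumes "B \<in> carrier_mat CARD('n) CARD('p)" 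
    and "\<And>i j. B $$ (pos i, pos j) = X $ i $ j"
  shows "of_hma (X :: real^'p::{finite,linorder}^'n::{finite,linorder}) = B"
proof (rule eq_matI)
  fix i j assume "i < dim_row B" "j < dim_col B"
  then obtain i' :: 'n and j' :: 'p where "i = pos i'" "j = pos j'"
    using assms(1) ex_pos[where 'a='n] ex_pos[where 'a='p] by (metis carrier_matD)
  then show "of_hma X $$ (i, j) = B $$ (i, j)"
    using assms(2) by simp
qed (use assms(1) in \<open>auto simp: of_hma_def\<close>)

lemma of_hma_to_hma:
  assumes "B \<in> carrier_mat CARD('n) CARD('p)"
  shows "of_hma (to_hma B :: real^'p::{finite,linorder}^'n::{finite,linorder}) = B"
  by (rule of_hma_eqI[OF assms]) (simp add: to_hma_def)

lemma of_hma_mult: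
  fixes X :: "real^'p::{finite,linorder}^'n::{finite,linorder}"
    and Y :: "real^'q::{finite,linorder}^'p::{finite,linorder}"
  shows "of_hma (X ** Y) = of_hma X * of_hma Y"
proof (rule of_hma_eqI)
  fix i :: 'n and j :: 'q
  have "(of_hma X * of_hma Y) $$ (pos i, pos j) =
      (\<Sum>k=0..<CARD('p). of_hma X $$ (pos i, k) * of_hma Y $$ (k, pos j))"
    using pos_less_card[of i] pos_less_card[of j] by (simp add: scalar_prod_def)
  also have "\<dots> = (X ** Y) $ i $ j"
    by (simp add: matrix_matrix_mult_def flip: sum_over_pos)
  finally show "(of_hma X * of_hma Y) $$ (pos i, pos j) = (X ** Y) $ i $ j" .
qed (simp add: carrier_matI)

lemma of_hma_transpose: "of_hma (transpose X) = transpose_mat (of_hma X)"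
  by (rule of_hma_eqI) (simp_all add: carrier_matI transpose_def pos_less_card)

lemma to_hma_mult:
  assumes "A \<in> carrier_mat CARD('n) CARD('p)" "B \<in> carrier_mat CARD('p) CARD('q)"
  shows "(to_hma (A * B) :: real^'q::{finite,linorder}^'n::{finite,linorder}) =
    (to_hma A :: real^'p::{finite,linorder}^'n::{finite,linorder}) ** to_hma B"
  using of_hma_mult[of "to_hma A :: real^'p::{finite,linorder}^'n::{finite,linorder}" "to_hma B :: real^'q::{finite,linorder}^'p::{finite,linorder}"]
  by (metis assms of_hma_to_hma to_hma_of_hma)

lemma to_hma_transpose:
  assumes "A \<in> carrier_mat CARD('n) CARD('p)"
  shows "(to_hma (transpose_mat A) :: real^'n::{finite,linorder}^'p::{finite,linorder}) = transpose (to_hma A)"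
  using of_hma_transpose[of "to_hma A :: real^'p::{finite,linorder}^'n::{finite,linorder}"]
  by (metis assms of_hma_to_hma to_hma_of_hma)

lemma trace_of_hma:
  "trace (Q :: real^'n::{finite,linorder}^'n::{finite,linorder}) = (\<Sum>i=0..<CARD('n). of_hma Q $$ (i, i))"
  by (simp add: trace_def flip: sum_over_pos)

section \<open>Eigenvalues of positive semidefinite matrices\<close>

lemma sum_diag_mult_comm:
  fixes A B :: "'a::comm_semiring_0 Matrix.mat"
  assumes "A \<in> carrier_mat n m" "B \<in> carrier_mat m n"
  shows "(\<Sum>i=0..<n. (A * B) $$ (i, i)) = (\<Sum>i=0..<m. (B * A) $$ (i, i))"
proof -
  have "(\<Sum>i=0..<n. (A * B) $$ (i, i)) = (\<Sum>i=0..<n. \<Sum>k=0..<m. A $$ (i, k) * B $$ (k, i))"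
    using assms by (auto simp: scalar_prod_def intro!: sum.cong)
  also have "\<dots> = (\<Sum>k=0..<m. \<Sum>i=0..<n. A $$ (i, k) * B $$ (k, i))"
    by (rule sum.swap)
  also have "\<dots> = (\<Sum>k=0..<m. (B * A) $$ (k, k))"
    using assms by (auto simp: scalar_prod_def mult.commute intro!: sum.cong)
  finally show ?thesis .
qed

lemma scalar_prod_mult_symmetric:
  fixes q :: "'a::comm_semiring_0 Matrix.mat"
  assumes "q \<in> carrier_mat n n" "transpose_mat q = q" "u \<in> carrier_vec n" "w \<in> carrier_vec n"
  shows "scalar_prod u (q *\<^sub>v w) = scalar_prod w (q *\<^sub>v u)"
proof -
  have "scalar_prod u (q *\<^sub>v w) = scalar_prod (transpose_mat q *\<^sub>v u) w"
    using transpose_vec_mult_scalar[OF assms(1,4,3)] by simp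
  also have "\<dots> = scalar_prod w (q *\<^sub>v u)"
    unfolding assms(2) using comm_scalar_prod[OF _ assms(4)] assms(1,3) by simp
  finally show ?thesis .
qed

text \<open>Split the eigenvector into real and imaginary parts \<open>u\<close> and
  \<open>w\<close>. Taking real and imaginary parts of the eigenvalue equation expresses
  \<open>q\<close> on the span of \<open>u\<close> and \<open>w\<close>. Symmetry of the form then
  forces \<open>Im a\<close> times the positive number |u|^2 + |w|^2 to vanish, and adding the
  quadratic forms at \<open>u\<close> and \<open>w\<close> gives \<open>Re a\<close> times that same
  number.\<close>

lemma psd_eigenvalue_nonneg_real:
  fixes q :: "real Matrix.mat" and a :: complex
  assumes q: "q \<in> carrier_mat n n" and sym: "transpose_mat q = q"
    and psd: "\<And>x. x \<in> carrier_vec n \<Longrightarrow> 0 \<le> scalar_prod x (q *\<^sub>v x)"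
    and a: "eigenvalue (map_mat complex_of_real q) a"
  shows "Im a = 0 \<and> 0 \<le> Re a"
proof -
  from a q obtain v where v: "v \<in> carrier_vec n" and v0: "v \<noteq> 0\<^sub>v n"
    and ev: "map_mat complex_of_real q *\<^sub>v v = a \<cdot>\<^sub>v v"
    unfolding eigenvalue_def eigenvector_def by auto
  define u w where "u = map_vec Re v" and "w = map_vec Im v"
  have u: "u \<in> carrier_vec n" and w: "w \<in> carrier_vec n"
    using v by (auto simp: u_def w_def)
  have ev': "(\<Sum>k=0..<n. complex_of_real (q $$ (i, k)) * vec_index v k) = a * vec_index v i" if "i < n" for i
    using arg_cong[OF ev, of "\<lambda>x. vec_index x i"] that q v by (simp add: scalar_prod_def)
  have qu: "q *\<^sub>v u = Re a \<cdot>\<^sub>v u - Im a \<cdot>\<^sub>v w"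
  proof (rule eq_vecI)
    fix i assume "i < dim_vec (Re a \<cdot>\<^sub>v u - Im a \<cdot>\<^sub>v w)"
    then have i: "i < n" using w by simp
    have "vec_index (q *\<^sub>v u) i = Re (a * vec_index v i)"
      unfolding ev'[OF i, symmetric] using i q v by (simp add: scalar_prod_def u_def)
    then show "vec_index (q *\<^sub>v u) i = vec_index (Re a \<cdot>\<^sub>v u - Im a \<cdot>\<^sub>v w) i"
      using i v by (simp add: u_def w_def)
  qed (use q w in auto)
  have qw: "q *\<^sub>v w = Re a \<cdot>\<^sub>v w + Im a \<cdot>\<^sub>v u"
  proof (rule eq_vecI)
    fix i assume "i < dim_vec (Re a \<cdot>\<^sub>v w + Im a \<cdot>\<^sub>v u)"
    then have i: "i < n" using u by simp
    have "vec_index (q *\<^sub>v w) i = Im (a * vec_index v i)"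
      unfolding ev'[OF i, symmetric] using i q v by (simp add: scalar_prod_def w_def)
    then show "vec_index (q *\<^sub>v w) i = vec_index (Re a \<cdot>\<^sub>v w + Im a \<cdot>\<^sub>v u) i"
      using i v by (simp add: u_def w_def)
  qed (use q u in auto)
  have wu: "scalar_prod w u = scalar_prod u w"
    by (rule comm_scalar_prod[OF w u])
  have "scalar_prod u (q *\<^sub>v w) = Re a * scalar_prod u w + Im a * scalar_prod u u"
    using u w by (simp add: qw scalar_prod_add_distrib[of _ n])
  moreover have "scalar_prod w (q *\<^sub>v u) = Re a * scalar_prod u w - Im a * scalar_prod w w"
    using u w wu by (simp add: qu scalar_prod_minus_distrib[of _ n])
  ultimately have 1: "Im a * (scalar_prod u u + scalar_prod w w) = 0"
    using scalar_prod_mult_symmetric[OF q sym u w] by (simp add: algebra_simps)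
  have nn: "0 \<le> scalar_prod u u" "0 \<le> scalar_prod w w"
    by (simp_all add: scalar_prod_def sum_nonneg)
  have "scalar_prod u u + scalar_prod w w \<noteq> 0"
  proof
    assume "scalar_prod u u + scalar_prod w w = 0"
    then have "scalar_prod u u = 0" "scalar_prod w w = 0"
      using nn by linarith+
    then have "vec_index u i = 0 \<and> vec_index w i = 0" if "i < n" for i
      using that u w by (simp add: scalar_prod_def sum_nonneg_eq_0_iff)
    then have "v = 0\<^sub>v n"
      using v by (intro eq_vecI) (auto simp: u_def w_def complex_eq_iff)
    with v0 show False by contradiction
  qed
  with 1 nn have im: "Im a = 0" and pos: "0 < scalar_prod u u + scalar_prod w w"
    by auto
  have "0 \<le> scalar_prod u (q *\<^sub>v u) + scalar_prod w (q *\<^sub>v w)"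
    using psd u w by (simp add: add_nonneg_nonneg)
  also have "\<dots> = Re a * (scalar_prod u u + scalar_prod w w)"
    using u w by (simp add: qu qw im scalar_prod_add_distrib[of _ n] scalar_prod_minus_distrib[of _ n] algebra_simps)
  finally show ?thesis
    using im pos by (simp add: zero_le_mult_iff)
qed

text \<open>Over the complex numbers the characteristic polynomial splits. All its roots are real
  and nonnegative by the preceding eigenvalue lemma, so the factorization is the image of a real one
  and descends because the coefficient embedding is injective on polynomials.\<close>

lemma psd_char_poly_factorized:
  fixes q :: "real Matrix.mat"
  assumes q: "q \<in> carrier_mat n n" and sym: "transpose_mat q = q"
    and psd: "\<And>x. x \<in> carrier_vec n \<Longrightarrow> 0 \<le> scalar_prod x (q *\<^sub>v x)"
  obtains es where "char_poly q = (\<Prod>e\<leftarrow>es. [:- e, 1:])" "length es = n" "\<forall>e\<in>set es. 0 \<le> e"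
proof -
  define qc where "qc = map_mat complex_of_real q"
  have qc: "qc \<in> carrier_mat n n"
    using q by (simp add: qc_def)
  obtain as where as: "char_poly qc = (\<Prod>a\<leftarrow>as. [:- a, 1:])" "length as = n"
    using char_poly_factorized[OF qc] by blast
  have "Im a = 0 \<and> 0 \<le> Re a" if "a \<in> set as" for a
  proof (rule psd_eigenvalue_nonneg_real[OF q sym psd])
    have "poly (char_poly qc) a = 0"
      using that unfolding as by (simp add: poly_prod_list prod_list_zero_iff image_iff)
    then show "eigenvalue (map_mat complex_of_real q) a"
      using eigenvalue_root_char_poly[OF qc] qc_def by simp
  qed
  then have real: "as = map complex_of_real (map Re as)" and nn: "\<forall>e\<in>set (map Re as). 0 \<le> e"
    by (auto simp: o_def complex_eq_iff intro!: map_idI[symmetric])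
  interpret mp: map_poly_inj_comm_ring_hom complex_of_real ..
  have "map_poly complex_of_real (char_poly q) = (\<Prod>a\<leftarrow>map complex_of_real (map Re as). [:- a, 1:])"
    using of_real_hom.char_poly_hom[OF q] as real qc_def by metis
  also have "\<dots> = map_poly complex_of_real (\<Prod>e\<leftarrow>map Re as. [:- e, 1:])"
    by (simp add: mp.hom_prod_list o_def)
  finally have "char_poly q = (\<Prod>e\<leftarrow>map Re as. [:- e, 1:])"
    by simp
  with nn as show thesis
    by (intro that[of "map Re as"]) auto
qed

lemma proots_linear_factors: "proots (\<Prod>e\<leftarrow>es. [:- e, 1:]) = mset (es :: real list)"
proof (induction es)
  case (Cons e es)
  have "(\<Prod>e\<leftarrow>es. [:- e, 1:]) \<noteq> 0"
    by (auto simp: prod_list_zero_iff)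
  with Cons show ?case
    by (simp add: proots_mult del: mult_pCons_left)
qed simp

text \<open>A Schur decomposition makes \<open>q\<close> similar to an upper triangular
  \<open>B\<close> with diagonal \<open>es\<close>. Similarity preserves the trace and carries
  \<open>q * q\<close> to \<open>B * B\<close>, whose diagonal consists of the squares of
  \<open>es\<close>. Since the entries of \<open>es\<close> are nonnegative, square roots recover
  them with multiplicity.\<close>

lemma psd_eigenvalues_square:
  fixes q :: "real Matrix.mat"
  assumes q: "q \<in> carrier_mat n n" and sym: "transpose_mat q = q"
    and psd: "\<And>x. x \<in> carrier_vec n \<Longrightarrow> 0 \<le> scalar_prod x (q *\<^sub>v x)"
  obtains es where "image_mset sqrt (proots (char_poly (q * q))) = mset es" "length es = n"
    "\<forall>e\<in>set es. 0 \<le> e" "sum_list es = (\<Sum>i=0..<n. q $$ (i, i))"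
proof -
  obtain es where es: "char_poly q = (\<Prod>e\<leftarrow>es. [:- e, 1:])" "length es = n" "\<forall>e\<in>set es. 0 \<le> e"
    using psd_char_poly_factorized[OF assms] by blast
  obtain B P P' where schur: "schur_decomposition q es = (B, P, P')"
    by (metis surj_pair)
  note sd = schur_decomposition[OF q es(1) schur]
  have sim: "B \<in> carrier_mat n n" "P \<in> carrier_mat n n" "P' \<in> carrier_mat n n"
    "P * P' = 1\<^sub>m n" "P' * P = 1\<^sub>m n" "q = P * B * P'"
    using similar_mat_witD2[OF q conjunct1[OF sd]] by auto
  have ut: "upper_triangular B" and diag: "diag_mat B = es"
    using sd by auto
  have dB: "B $$ (i, i) = es ! i" if "i < n" for i
    using that sim(1) unfolding diag[symmetric] by (simp add: diag_mat_def)
  have "(\<Sum>i=0..<n. q $$ (i, i)) = (\<Sum>i=0..<n. (P' * (P * B)) $$ (i, i))"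
    unfolding sim(6) by (rule sum_diag_mult_comm) (use sim in auto)
  also have "P' * (P * B) = B"
    by (simp only: assoc_mult_mat[OF sim(3,2,1), symmetric] sim(5) left_mult_one_mat[OF sim(1)])
  also have "(\<Sum>i=0..<n. B $$ (i, i)) = sum_list es"
    using es(2) dB by (simp add: sum_list_sum_nth)
  finally have tr: "sum_list es = (\<Sum>i=0..<n. q $$ (i, i))" ..
  have BB: "(B * B) $$ (i, j) = (\<Sum>k=0..<n. B $$ (i, k) * B $$ (k, j))" if "i < n" "j < n" for i j
    using that sim(1) by (auto simp: scalar_prod_def)
  have B0: "B $$ (i, j) = 0" if "j < i" "i < n" for i j
    using ut that sim(1) by auto
  have ut2: "upper_triangular (B * B)"
  proof
    fix i j assume "j < i" "i < dim_row (B * B)"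
    then have ij: "j < i" "i < n" using sim(1) by auto
    \<comment> \<open>For \<open>k < i\<close> the first factor lies below the diagonal; otherwise
      \<open>j < i \<le> k\<close> and the second one does.\<close>
    have "B $$ (i, k) * B $$ (k, j) = 0" if "k < n" for k
      using B0[of k i] B0[of j k] ij that by (cases "k < i") auto
    then show "(B * B) $$ (i, j) = 0"
      using ij by (simp add: BB sum.neutral)
  qed
  have "(B * B) $$ (i, i) = es ! i * es ! i" if "i < n" for i
  proof -
    have "B $$ (i, k) * B $$ (k, i) = (if k = i then es ! i * es ! i else 0)" if "k < n" for k
      using B0[of k i] B0[of i k] \<open>i < n\<close> that dB by (cases k i rule: linorder_cases) auto
    then show ?thesis
      using that by (simp add: BB)
  qed
  then have diag2: "diag_mat (B * B) = map (\<lambda>e. e * e) es"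
    using es(2) sim(1) by (intro nth_equalityI) (auto simp: diag_mat_def)
  have "q * q = P * (B * B) * P'"
  proof -
    have BP': "B * P' \<in> carrier_mat n n" and BB_carrier: "B * B \<in> carrier_mat n n"
      using sim by auto
    have "q * q = P * B * (P' * (P * B * P'))"
      unfolding sim(6) by (rule assoc_mult_mat) (use sim in auto)
    also have "P' * (P * B * P') = P' * P * (B * P')"
      by (simp only: assoc_mult_mat[OF sim(2,1,3)] assoc_mult_mat[OF sim(3,2) BP'])
    also have "\<dots> = B * P'"
      unfolding sim(5) by (rule left_mult_one_mat[OF BP'])
    also have "P * B * (B * P') = P * (B * B) * P'"
      by (simp only: assoc_mult_mat[OF sim(2,1) BP'] assoc_mult_mat[OF sim(2) BB_carrier sim(3)]
          assoc_mult_mat[OF sim(1,1,3)])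
    finally show ?thesis .
  qed
  then have "similar_mat (q * q) (B * B)"
    using sim q by (intro similar_matI[of _ _ P P' n]) auto
  then have "char_poly (q * q) = char_poly (B * B)"
    by (rule char_poly_similar)
  also have "\<dots> = (\<Prod>e\<leftarrow>map (\<lambda>e. e * e) es. [:- e, 1:])"
    using char_poly_upper_triangular[OF _ ut2, of n] sim(1) diag2 by simp
  finally have "proots (char_poly (q * q)) = mset (map (\<lambda>e. e * e) es)"
    using proots_linear_factors by metis
  then have "image_mset sqrt (proots (char_poly (q * q))) = mset (map (\<lambda>e. sqrt (e * e)) es)"
    by (simp add: multiset.map_comp o_def)
  also have "map (\<lambda>e. sqrt (e * e)) es = es"
    using es(3) by (intro map_idI) auto
  finally show thesis
    using that es tr by blast
qed

text \<open>A positive semidefinite square root \<open>Q\<close> of the Gram matrix has the singular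
  values of \<open>X\<close> as its eigenvalues. This is how nuclear norms are computed: exhibit
  such a \<open>Q\<close> and take its trace.\<close>

lemma singular_values_psd:
  fixes X :: "real^'p::{finite,linorder}^'n::{finite,linorder}"
  assumes Q: "Q \<in> psd_mats" and XQ: "transpose X ** X = Q ** Q"
  shows "length (singular_values X) = CARD('p)" "\<forall>e\<in>set (singular_values X). 0 \<le> e"
    "nuclear_norm X = trace Q"
proof -
  have psd: "0 \<le> scalar_prod x (of_hma Q *\<^sub>v x)" if x: "x \<in> carrier_vec CARD('p)" for x
  proof -
    define y :: "real^'p::{finite,linorder}" where "y = (\<chi> i. vec_index x (pos i))"
    have "scalar_prod x (of_hma Q *\<^sub>v x) = 
        (\<Sum>i=0..<CARD('p). vec_index x i * (\<Sum>j=0..<CARD('p). of_hma Q $$ (i, j) * vec_index x j))"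
      using x by (simp add: scalar_prod_def)
    also have "\<dots> = y \<bullet> (Q *v y)"
      by (simp add: y_def inner_vec_def matrix_vector_mult_def flip: sum_over_pos)
    finally show ?thesis
      using Q by (simp add: psd_mats_def)
  qed
  have sym: "transpose_mat (of_hma Q) = of_hma Q"
    using Q by (simp add: psd_mats_def flip: of_hma_transpose)
  obtain es where es: "image_mset sqrt (proots (char_poly (of_hma Q * of_hma Q))) = mset es"
    "length es = CARD('p)" "\<forall>e\<in>set es. 0 \<le> e" "sum_list es = trace Q"
    using psd_eigenvalues_square[OF of_hma_carrier sym psd] unfolding trace_of_hma by blast
  have sv: "mset (singular_values X) = mset es"
    unfolding singular_values_def XQ of_hma_mult es(1) by simp
  show "length (singular_values X) = CARD('p)" 
    using mset_eq_length[OF sv] es by simp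
  show "\<forall>e\<in>set (singular_values X). 0 \<le> e" 
    using mset_eq_setD[OF sv] es by simp
  show "nuclear_norm X = trace Q"
    unfolding nuclear_norm_def using es(4) sv by (metis sum_mset_sum_list)
qed

section \<open>Positive semidefinite and diagonal matrices\<close>

lemma trace_mult_comm:
  fixes A :: "real^'m^'n" and B :: "real^'n^'m"
  shows "trace (A ** B) = trace (B ** A)"
  unfolding trace_def matrix_matrix_mult_def
  by (simp add: mult.commute) (rule sum.swap)

lemma psd_mats_congruence:
  fixes N :: "real^'n^'n" and B :: "real^'m^'n"
  assumes "N \<in> psd_mats"
  shows "transpose B ** N ** B \<in> psd_mats"
proof -
  have "x \<bullet> (transpose B ** N ** B *v x) = (B *v x) \<bullet> (N *v (B *v x))" for x
  proof -
    have "x \<bullet> (transpose B *v z) = (B *v x) \<bullet> z" for z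
      by (metis dot_lmul_matrix inner_commute transpose_matrix_vector)
    then show ?thesis
      by (simp flip: matrix_vector_mul_assoc)
  qed
  then show ?thesis
    using assms by (simp add: psd_mats_def matrix_transpose_mul matrix_mul_assoc)
qed

lemma transpose_nth [simp]: "transpose A $ i $ j = A $ j $ i"
  by (simp add: transpose_def)

lemma psd_mats_add: "P \<in> psd_mats \<Longrightarrow> Q \<in> psd_mats \<Longrightarrow> P + Q \<in> psd_mats"
  by (auto simp: psd_mats_def matrix_vector_mult_add_rdistrib inner_add_right Finite_Cartesian_Product.vec_eq_iff)

lemma psd_mats_scaleR: "P \<in> psd_mats \<Longrightarrow> 0 \<le> c \<Longrightarrow> c *\<^sub>R P \<in> psd_mats"
  by (auto simp: psd_mats_def scaleR_matrix_vector_assoc[symmetric] Finite_Cartesian_Product.vec_eq_iff)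

definition diag_matrix :: "('n \<Rightarrow> real) \<Rightarrow> real^'n^'n" where
  "diag_matrix d = (\<chi> i j. if i = j then d i else 0)"

lemma diag_matrix_nth: "diag_matrix d $ i $ j = (if i = j then d i else 0)"
  by (simp add: diag_matrix_def)

lemma transpose_diag_matrix [simp]: "transpose (diag_matrix d) = diag_matrix d"
  by (simp add: diag_matrix_nth Finite_Cartesian_Product.vec_eq_iff)

lemma diag_matrix_mult_nth: "(diag_matrix d ** A) $ i $ j = d i * A $ i $ j"
  by (simp add: diag_matrix_def matrix_matrix_mult_def if_distrib if_distribR cong: if_cong)

lemma diag_matrix_vector_nth: "(diag_matrix d *v x) $ i = d i * x $ i"
  by (simp add: diag_matrix_def matrix_vector_mult_def if_distrib if_distribR cong: if_cong)

lemma diag_matrix_quadratic: "x \<bullet> (diag_matrix d *v x) = (\<Sum>i\<in>UNIV. d i * (x $ i)\<^sup>2)"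
  by (simp add: inner_vec_def diag_matrix_vector_nth power2_eq_square mult_ac)

lemma diag_matrix_psd: "(\<And>i. 0 \<le> d i) \<Longrightarrow> diag_matrix d \<in> psd_mats"
  by (simp add: psd_mats_def diag_matrix_quadratic sum_nonneg)

text \<open>Restricting a vector to the support of \<open>d\<close> does not change the quadratic form of \<open>S\<close>, and
  on the support \<open>diag_matrix d\<close> is bounded below by the smallest nonzero \<open>d i\<close>.\<close>

lemma diag_matrix_minus_psd:
  fixes S :: "real^'n^'n"
  assumes d: "\<And>i. 0 \<le> d i" and S: "transpose S = S"
    and supp: "\<And>i j. S $ i $ j \<noteq> 0 \<Longrightarrow> d i \<noteq> 0 \<and> d j \<noteq> 0"
  obtains c where "0 < c" "diag_matrix d - c *\<^sub>R S \<in> psd_mats"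
proof -
  obtain K where K: "0 < K" "\<And>y. norm (S *v y) \<le> norm y * K"
    using bounded_linear.pos_bounded[OF matrix_vector_mul_bounded_linear[of S]] by blast
  \<comment> \<open>The inserted 1 keeps the set nonempty when \<open>d\<close> vanishes
    identically; \<open>m\<close> stays a positive lower bound for the nonzero
    \<open>d i\<close>.\<close>
  define m where "m = Min (insert 1 {d i |i. d i \<noteq> 0})"
  have fin: "finite (insert 1 {d i |i. d i \<noteq> 0})"
    by simp
  have "0 < m"
    unfolding m_def using d by (subst Min_gr_iff[OF fin]) (auto simp: order_less_le)
  have m: "m \<le> d i" if "d i \<noteq> 0" for i
    unfolding m_def using that by (intro Min_le[OF fin]) auto
  have "0 \<le> x \<bullet> ((diag_matrix d - (m / K) *\<^sub>R S) *v x)" for x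
  proof -
    define y :: "real^'n" where "y = (\<chi> i. if d i = 0 then 0 else x $ i)"
    have sym: "S $ i $ j * x $ j = S $ i $ j * y $ j" "x $ i * (S $ i $ j * z) = y $ i * (S $ i $ j * z)" for i j z
      using supp[of i j] by (auto simp: y_def)
    have "x \<bullet> (S *v x) = y \<bullet> (S *v y)"
      by (simp add: inner_vec_def matrix_vector_mult_def sum_distrib_left sym)
    also have "\<dots> \<le> norm y * norm (S *v y)"
      by (rule norm_cauchy_schwarz)
    also have "\<dots> \<le> norm y * (norm y * K)"
      by (intro mult_left_mono K) simp
    finally have "x \<bullet> (S *v x) \<le> K * (y \<bullet> y)"
      by (simp add: dot_square_norm power2_eq_square mult_ac)
    then have "m / K * (x \<bullet> (S *v x)) \<le> m / K * (K * (y \<bullet> y))"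
      using \<open>0 < m\<close> K(1) by (intro mult_left_mono) auto
    also have "\<dots> = (\<Sum>i\<in>UNIV. m * (y $ i)\<^sup>2)"
      using K(1) by (simp add: inner_vec_def power2_eq_square sum_distrib_left)
    also have "\<dots> \<le> (\<Sum>i\<in>UNIV. d i * (x $ i)\<^sup>2)"
      by (intro sum_mono) (auto simp: y_def intro: mult_right_mono m)
    also have "\<dots> = x \<bullet> (diag_matrix d *v x)"
      by (simp add: diag_matrix_quadratic)
    finally show ?thesis
      by (simp add: matrix_vector_mult_diff_rdistrib scaleR_matrix_vector_assoc[symmetric] inner_diff_right)
  qed
  moreover have "transpose (diag_matrix d - (m / K) *\<^sub>R S) = diag_matrix d - (m / K) *\<^sub>R S"
    using S by (simp add: Finite_Cartesian_Product.vec_eq_iff diag_matrix_nth)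
  ultimately show thesis
    using \<open>0 < m\<close> K(1) by (intro that[of "m / K"]) (auto simp: psd_mats_def)
qed

text \<open>With \<open>B = D ** transpose V\<close>, the positive semidefinite square root of the Gram matrix is
  \<open>transpose B ** N ** B\<close>.\<close>

lemma nuclear_norm_psd_isometry:
  fixes N :: "real^'n::{finite,linorder}^'n::{finite,linorder}"
    and D :: "real^'p::{finite,linorder}^'n::{finite,linorder}"
  assumes N: "N \<in> psd_mats" and ND: "N ** (D ** transpose D) = N"
    and U: "orthogonal_matrix U" and V: "orthogonal_matrix V"
  shows "nuclear_norm (U ** N ** D ** transpose V) = trace N"
proof -
  have UU: "transpose U ** U = mat 1" and VV: "transpose V ** V = mat 1"
    using U V by (auto simp: orthogonal_matrix_def)
  have NT: "transpose N = N"
    using N by (simp add: psd_mats_def)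
  define B where "B = D ** transpose V"
  have "B ** transpose B = D ** (transpose V ** V) ** transpose D"
    by (simp add: B_def matrix_transpose_mul matrix_mul_assoc)
  then have BB: "N ** (B ** transpose B) = N"
    using ND by (simp add: VV)
  define Q where "Q = transpose B ** N ** B"
  have "transpose (U ** N ** B) ** (U ** N ** B) = transpose B ** N ** (transpose U ** U) ** N ** B"
    by (simp add: matrix_transpose_mul NT matrix_mul_assoc)
  \<comment> \<open>Expanding the left \<open>N\<close> to \<open>N ** (B ** transpose B)\<close>
    creates the two inner factors that complete a second copy of \<open>Q\<close>.\<close>
  also have "\<dots> = transpose B ** (N ** (B ** transpose B)) ** N ** B"
    by (simp add: UU BB)
  also have "\<dots> = Q ** Q"
    by (simp add: Q_def matrix_mul_assoc)
  finally have "nuclear_norm (U ** N ** B) = trace Q"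
    using psd_mats_congruence[OF N] by (intro singular_values_psd(3)) (simp_all add: Q_def)
  also have "\<dots> = trace (B ** (transpose B ** N))"
    unfolding Q_def by (rule trace_mult_comm)
  also have "\<dots> = trace (B ** transpose B ** N)"
    by (simp add: matrix_mul_assoc)
  also have "\<dots> = trace (N ** (B ** transpose B))"
    by (rule trace_mult_comm)
  also have "U ** N ** B = U ** N ** D ** transpose V"
    by (simp add: B_def matrix_mul_assoc)
  finally show ?thesis
    by (simp only: BB)
qed

section \<open>Blocks and rectangular diagonal matrices\<close>

lemma matrix_mult_add_right: "(A + B) ** C = A ** C + B ** C" for A B :: "real^'m^'n"
  by (simp add: Finite_Cartesian_Product.vec_eq_iff matrix_matrix_mult_def sum.distrib distrib_right)

text \<open>Entries with a row or column index below \<open>r\<close> do not see the block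
  \<open>B\<close>. These are the ones needed after left multiplication by a diagonal matrix
  supported on the first \<open>r\<close> rows.\<close>

lemma id_block_nth:
  fixes B :: "real Matrix.mat"
  assumes "B \<in> carrier_mat (CARD('n) - r) (CARD('p) - r)" "r \<le> CARD('n)" "r \<le> CARD('p)"
    and "pos i < r \<or> pos j < r"
  shows "(id_block r B :: real^'p::{finite,linorder}^'n::{finite,linorder}) $ i $ j = (if pos i = pos j then 1 else 0)"
proof -
  have B: "dim_row B = CARD('n) - r" "dim_col B = CARD('p) - r"
    using assms(1) by auto
  have "pos i < r + (CARD('n) - r)" "pos j < r + (CARD('p) - r)"
    using assms(2,3) pos_less_card[of i] pos_less_card[of j] by linarith+
  moreover have "\<not> pos i < r \<Longrightarrow> pos i - r < CARD('n) - r" "\<not> pos j < r \<Longrightarrow> pos j - r < CARD('p) - r"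
    using pos_less_card[of i] pos_less_card[of j] by linarith+
  ultimately show ?thesis
    using assms(4) by (auto simp: id_block_def to_hma_def B)
qed

text \<open>Blockwise multiplication. It turns the last condition in \<open>W_set\<close> into
  \<open>M ** (D ** transpose D) = M\<close>, the form used by
  \<open>nuclear_norm_psd_isometry\<close>.\<close>

lemma id_block_mult_transpose:
  fixes R :: "real Matrix.mat"
  assumes R: "R \<in> stiefel (CARD('n) - r) (CARD('p) - r)" and r: "r \<le> CARD('n)" "r \<le> CARD('p)"
  defines "D \<equiv> id_block r R :: real^'p::{finite,linorder}^'n::{finite,linorder}"
  shows "D ** transpose D = id_block r (R * transpose_mat R)"
proof -
  have Rc: "R \<in> carrier_mat (CARD('n) - r) (CARD('p) - r)"
    using R by (simp add: stiefel_def)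
  define F where "F = four_block_mat (1\<^sub>m r) (0\<^sub>m r (dim_col R)) (0\<^sub>m (dim_row R) r) R"
  have F: "F \<in> carrier_mat CARD('n) CARD('p)"
    using Rc r unfolding F_def by (intro carrier_matI) auto
  have RT: "transpose_mat R \<in> carrier_mat (CARD('p) - r) (CARD('n) - r)"
    using Rc by simp
  have F4: "F = four_block_mat (1\<^sub>m r) (0\<^sub>m r (CARD('p) - r)) (0\<^sub>m (CARD('n) - r) r) R"
    using Rc by (simp add: F_def)
  have FT: "transpose_mat F = four_block_mat (1\<^sub>m r) (0\<^sub>m r (CARD('n) - r)) (0\<^sub>m (CARD('p) - r) r) (transpose_mat R)"
    unfolding F4 transpose_four_block_mat[OF one_carrier_mat zero_carrier_mat zero_carrier_mat Rc]
    by simp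
  have "F * transpose_mat F = four_block_mat (1\<^sub>m r) (0\<^sub>m r (CARD('n) - r)) (0\<^sub>m (CARD('n) - r) r) (R * transpose_mat R)"
    unfolding FT unfolding F4 mult_four_block_mat[OF one_carrier_mat zero_carrier_mat zero_carrier_mat Rc
        one_carrier_mat zero_carrier_mat zero_carrier_mat RT]
    using Rc RT by simp
  moreover have "D ** transpose D = to_hma (F * transpose_mat F)"
    using F unfolding D_def id_block_def F_def[symmetric]
    by (simp add: to_hma_mult[of F, where 'p='p] to_hma_transpose)
  ultimately show ?thesis
    using Rc by (simp add: id_block_def)
qed

text \<open>As p \<le> n, each diagonal position of a column occurs among the rows, so no entry of
  \<open>s\<close> is cut off. The signs of the entries of \<open>s\<close> are arbitrary here;
  absolute values make each factor on the right positive semidefinite.\<close>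

lemma transpose_rect_diag_mult:
  assumes "CARD('p) \<le> CARD('n)"
  shows "transpose (rect_diag s :: real^'p::{finite,linorder}^'n::{finite,linorder}) ** rect_diag s =
    diag_matrix (\<lambda>j. \<bar>s ! pos j\<bar>) ** diag_matrix (\<lambda>j. \<bar>s ! pos j\<bar>)"
proof -
  have "(\<Sum>k\<in>(UNIV :: 'n set). (if pos k = pos i then s ! pos i else 0) * (if pos k = pos j then s ! pos j else 0)) =
      (if i = j then s ! pos j * s ! pos j else 0)"
 for i j :: 'p
  proof -
    let ?f = "\<lambda>k. (if k = pos i then s ! pos i else 0) * (if k = pos j then s ! pos j else 0)"
    have "(\<Sum>k\<in>(UNIV :: 'n set). ?f (pos k)) = (\<Sum>k=0..<CARD('n). ?f k)"
      by (rule sum_over_pos)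
    also have "\<dots> = (\<Sum>k=0..<CARD('n). if k = pos i then (if pos i = pos j then s ! pos j * s ! pos j else 0) else 0)"
      by (intro sum.cong) auto
    also have "\<dots> = (if i = j then s ! pos j * s ! pos j else 0)"
      using assms pos_less_card[of i] by (simp add: inj_eq[OF inj_pos])
    finally show ?thesis .
  qed
  then show ?thesis
    by (simp add: Finite_Cartesian_Product.vec_eq_iff diag_matrix_mult_nth diag_matrix_nth matrix_matrix_mult_def[of "transpose _"] rect_diag_def)
qed

section \<open>Rank and singular values\<close>

lemma rank_orthogonal_mult:
  fixes U :: "real^'n^'n" and V :: "real^'p^'p" and B :: "real^'p^'n"
  assumes "orthogonal_matrix U" "orthogonal_matrix V"
  shows "rank (U ** B ** transpose V) = rank B"
proof (rule antisym)
  show "rank (U ** B ** transpose V) \<le> rank B"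
    by (meson order_trans rank_mul_le_left rank_mul_le_right)
  have "B = (transpose U ** U) ** B ** (transpose V ** V)"
    using assms by (simp add: orthogonal_matrix_def)
  also have "\<dots> = transpose U ** (U ** B ** transpose V) ** V"
    by (simp add: matrix_mul_assoc)
  finally show "rank B \<le> rank (U ** B ** transpose V)"
    by (metis order_trans rank_mul_le_left rank_mul_le_right)
qed

lemma rank_rect_diag:
  assumes "CARD('p) \<le> CARD('n)"
  shows "rank (rect_diag s :: real^'p::{finite,linorder}^'n::{finite,linorder}) = card {k. k < CARD('p) \<and> s ! k \<noteq> 0}"
proof -
  let ?D = "rect_diag s :: real^'p::{finite,linorder}^'n::{finite,linorder}"
  \<comment> \<open>The order-preserving embedding of column indices into row indices exists because
    p \<le> n. Column \<open>j\<close> is then a multiple of a coordinate vector, and the nonzero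
    columns are pairwise orthogonal.\<close>
  obtain \<iota> :: "'p \<Rightarrow> 'n" where \<iota>: "\<And>j. pos (\<iota> j) = pos j"
  proof -
    have "\<exists>i :: 'n. pos i = pos j" for j :: 'p
      using ex_pos[of "pos j", where 'a='n] assms pos_less_card[of j] by fastforce
    then show thesis
      using that by metis
  qed
  have pos_eq: "pos i = pos j \<longleftrightarrow> \<iota> j = i" for i j
    unfolding \<iota>[of j, symmetric] by (auto dest: injD[OF inj_pos])
  have inj: "\<iota> i = \<iota> j \<longleftrightarrow> i = j" for i j
    by (metis \<iota> injD inj_pos)
  let ?v = "\<lambda>j. axis (\<iota> j) (s ! pos j) :: real^'n::{finite,linorder}"
  have col: "column j ?D = ?v j" for j
    by (simp add: Finite_Cartesian_Product.vec_eq_iff column_def rect_diag_def axis_def pos_eq)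
  define J where "J = {j :: 'p. s ! pos j \<noteq> 0}"
  have indep: "independent (?v ` J)"
  proof (rule pairwise_orthogonal_independent)
    show "pairwise orthogonal (?v ` J)"
      by (auto simp: pairwise_def Linear_Algebra.orthogonal_def inner_axis_axis inj)
    show "0 \<notin> ?v ` J"
      by (auto simp: J_def axis_eq_0_iff)
  qed
  have "columns ?D \<subseteq> span (?v ` J)"
  proof
    fix x assume "x \<in> columns ?D"
    then obtain j where "x = ?v j"
      by (auto simp: columns_def col)
    then show "x \<in> span (?v ` J)"
      by (cases "j \<in> J") (auto simp: J_def axis_eq_0_iff[THEN iffD2] intro: span_base span_zero)
  qed
  moreover have "?v ` J \<subseteq> columns ?D"
    by (auto simp: columns_def col)
  moreover have "inj_on ?v J"
    by (auto simp: inj_on_def J_def axis_eq_axis inj)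
  ultimately have "dim (columns ?D) = card J"
    using indep by (intro dim_unique) (auto simp: card_image)
  also have "\<dots> = card (pos ` J)"
    by (simp add: card_image inj_on_subset[OF inj_pos])
  also have "pos ` J = {k. k < CARD('p) \<and> s ! k \<noteq> 0}"
    using ex_pos[where 'a='p] by (auto simp: J_def pos_less_card image_iff)
  finally show ?thesis
    by (simp add: column_rank_def)
qed

text \<open>The square root \<open>Q\<close> obtained from the decomposition gives the length and
  nonnegativity of the list of singular values. The rank counts the nonzero entries, and as the list
  is nonincreasing these occupy exactly the first \<open>rank X\<close> positions.\<close>

lemma singular_values_svd:
  fixes X :: "real^'p::{finite,linorder}^'n::{finite,linorder}"
  assumes np: "CARD('p) \<le> CARD('n)" and U: "orthogonal_matrix U" and V: "orthogonal_matrix V"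
    and X: "X = U ** rect_diag (singular_values X) ** transpose V"
  shows "k < rank X \<Longrightarrow> 0 < singular_values X ! k"
    and "rank X \<le> k \<Longrightarrow> k < CARD('p) \<Longrightarrow> singular_values X ! k = 0"
proof -
  define s where "s = singular_values X"
  define d where "d = (\<lambda>j :: 'p. \<bar>s ! pos j\<bar>)"
  define D where "D = (rect_diag s :: real^'p::{finite,linorder}^'n::{finite,linorder})"
  define Q where "Q = V ** diag_matrix d ** transpose V"
  have XD: "X = U ** D ** transpose V"
    using X by (simp add: D_def s_def)
  have "Q \<in> psd_mats"
    using psd_mats_congruence[of "diag_matrix d" "transpose V"] diag_matrix_psd[of d]
    by (simp add: Q_def d_def)
  moreover have "transpose X ** X = Q ** Q"
  proof -
    have "transpose X ** X = V ** transpose D ** (transpose U ** U) ** D ** transpose V"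
      by (simp add: XD matrix_transpose_mul matrix_mul_assoc)
    also have "\<dots> = V ** (transpose D ** D) ** transpose V"
      using U by (simp add: orthogonal_matrix_def matrix_mul_assoc)
    also have "\<dots> = V ** diag_matrix d ** (transpose V ** V) ** diag_matrix d ** transpose V"
      using V by (simp add: orthogonal_matrix_def D_def d_def transpose_rect_diag_mult[OF np] matrix_mul_assoc)
    also have "\<dots> = Q ** Q"
      by (simp add: Q_def matrix_mul_assoc)
    finally show ?thesis .
  qed
  ultimately have len: "length s = CARD('p)" and nn: "\<forall>e\<in>set s. 0 \<le> e"
    using singular_values_psd unfolding s_def by blast+
  have "sorted (rev s)"
    by (simp add: s_def singular_values_def)
  then have anti: "s ! j \<le> s ! i" if "i \<le> j" "j < CARD('p)" for i j
    using that len by (simp add: sorted_rev_iff_nth_mono)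
  define K where "K = {k. k < CARD('p) \<and> s ! k \<noteq> 0}"
  have "rank X = card K"
    unfolding XD rank_orthogonal_mult[OF U V] unfolding D_def K_def by (rule rank_rect_diag[OF np])
  moreover have "K = {..<card K}"
  proof -
    have down: "i \<in> K" if "j \<in> K" "i \<le> j" for i j
    proof -
      have j: "j < CARD('p)" "s ! j \<noteq> 0"
        using that(1) by (simp_all add: K_def)
      then have "0 < s ! j"
        using nn len by (simp add: order_less_le)
      then show ?thesis
        using anti[OF that(2) j(1)] that(2) j(1) by (simp add: K_def)
    qed
    have fin: "finite K"
      by (simp add: K_def)
    have "j < card K" if "j \<in> K" for j
    proof -
      \<comment> \<open>The \<open>j + 1\<close> indices up to \<open>j\<close> all belong to the
        downward closed set \<open>K\<close>.\<close>
      have "card {..j} \<le> card K"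
        by (intro card_mono fin) (auto intro: down[OF that])
      then show ?thesis by simp
    qed
    then show ?thesis
      by (intro card_subset_eq) auto
  qed
  ultimately have K: "k \<in> K \<longleftrightarrow> k < rank X" for k
    by (metis lessThan_iff)
  show "0 < singular_values X ! k" if "k < rank X"
    using that nn len unfolding K[symmetric] s_def[symmetric] K_def by (simp add: order_less_le)
  show "singular_values X ! k = 0" if "rank X \<le> k" "k < CARD('p)"
    using that K[of k] unfolding s_def[symmetric] K_def by auto
qed

section \<open>The set \<open>W_set\<close>\<close>

lemma nuclear_norm_constant_along_W:
  fixes X :: "real^'p::{finite,linorder}^'n::{finite,linorder}"
  assumes np: "CARD('p) \<le> CARD('n)" and U: "orthogonal_matrix U" and V: "orthogonal_matrix V"
    and X: "X = U ** rect_diag (singular_values X) ** transpose V" and Z: "Z \<in> W_set U V X"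
  obtains c where "0 < c" "nuclear_norm (X + c *\<^sub>R Z) = nuclear_norm X"
proof -
  define r where "r = rank X"
  have r: "r \<le> CARD('n)" "r \<le> CARD('p)"
    using rank_bound[of X] by (auto simp: r_def)
  from Z obtain M R P S where ZM: "Z = U ** M ** id_block r R ** transpose V"
    and M: "M = P - S" and P: "P \<in> psd_mats" and S: "S \<in> pd_block_mats r"
    and tr: "trace M = 0" and R: "R \<in> stiefel (CARD('n) - r) (CARD('p) - r)"
    and MR: "M ** id_block r (R * transpose_mat R) = M"
    unfolding W_set_def r_def by blast
  define D where "D = (id_block r R :: real^'p::{finite,linorder}^'n::{finite,linorder})"
  have Rc: "R \<in> carrier_mat (CARD('n) - r) (CARD('p) - r)"
    using R by (simp add: stiefel_def)
  have DD: "D ** transpose D = id_block r (R * transpose_mat R)"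
    unfolding D_def by (rule id_block_mult_transpose[OF R r])
  \<comment> \<open>The n by n diagonal matrix with entries \<open>d\<close> plays the role of
    \<Sigma>: the first \<open>r\<close> singular values, padded by zeros.\<close>
  define d where "d = (\<lambda>i :: 'n. if pos i < r then singular_values X ! pos i else 0)"
  have dpos: "0 < d i \<longleftrightarrow> pos i < r" and d0: "0 \<le> d i" for i
    using singular_values_svd(1)[OF np U V X, of "pos i"] by (auto simp: d_def r_def)
  \<comment> \<open>In rows with \<open>pos i \<ge> r\<close> the left side vanishes since
    \<open>d i = 0\<close>, the right side since the singular values from index
    \<open>rank X\<close> on are zero.\<close>
  have "(diag_matrix d ** D) $ i $ j = rect_diag (singular_values X) $ i $ j" for i j
    using id_block_nth[OF Rc r, of i j] singular_values_svd(2)[OF np U V X, of "pos j"] pos_less_card[of j]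
    by (auto simp: diag_matrix_mult_nth rect_diag_def D_def d_def r_def not_less)
  then have dD: "diag_matrix d ** D = rect_diag (singular_values X)"
    by (simp add: Finite_Cartesian_Product.vec_eq_iff)
  have XD: "X = U ** diag_matrix d ** D ** transpose V"
    using X dD by (simp add: matrix_mul_assoc[symmetric])
  have "R * transpose_mat R \<in> carrier_mat (CARD('n) - r) (CARD('n) - r)"
    using Rc by simp
  note RR = id_block_nth[OF this r(1) r(1)]
  have "(diag_matrix d ** (D ** transpose D)) $ i $ j = diag_matrix d $ i $ j" for i j
    using RR[of i j] by (auto simp: DD diag_matrix_mult_nth diag_matrix_nth d_def inj_eq[OF inj_pos])
  then have dDD: "diag_matrix d ** (D ** transpose D) = diag_matrix d"
    by (simp add: Finite_Cartesian_Product.vec_eq_iff)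
  have "transpose S = S"
    using S by (simp add: pd_block_mats_def psd_mats_def)
  \<comment> \<open>\<open>S\<close> vanishes outside the leading r by r block, and on that block
    the \<open>d i\<close> are positive. This is the support condition of
    \<open>diag_matrix_minus_psd\<close>.\<close>
  moreover have "d i \<noteq> 0 \<and> d j \<noteq> 0" if "S $ i $ j \<noteq> 0" for i j
  proof -
    have "pos i < r \<and> pos j < r"
      using S that pos_less_card[of i] pos_less_card[of j]
      by (auto simp: pd_block_mats_def pd_mats_def to_hma_def split: if_splits)
    then show ?thesis
      using dpos[of i] dpos[of j] by simp
  qed
  ultimately obtain c where c: "0 < c" "diag_matrix d - c *\<^sub>R S \<in> psd_mats"
    using diag_matrix_minus_psd[of d S] d0 by blast
  define N where "N = diag_matrix d + c *\<^sub>R M"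
  have "N = (diag_matrix d - c *\<^sub>R S) + c *\<^sub>R P"
    by (simp add: N_def M scaleR_diff_right)
  then have Npsd: "N \<in> psd_mats"
    using psd_mats_add[OF c(2) psd_mats_scaleR[OF P]] c(1) by simp
  have ND: "N ** (D ** transpose D) = N"
    using MR dDD unfolding DD N_def by (simp add: matrix_mult_add_right scalar_matrix_assoc[symmetric])
  have "trace N = trace (diag_matrix d) + c * trace M"
    by (simp add: N_def trace_def sum.distrib sum_distrib_left)
  then have "trace N = trace (diag_matrix d)"
    using tr by simp
  moreover have "X + c *\<^sub>R Z = U ** N ** D ** transpose V"
    unfolding XD ZM N_def D_def[symmetric]
    by (simp add: matrix_mult_add_right matrix_add_ldistrib matrix_scalar_ac scalar_matrix_assoc[symmetric])
  \<comment> \<open>The isometry lemma is applied to \<open>N\<close> and to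
    \<open>diag_matrix d\<close>; the second application evaluates
    \<open>nuclear_norm X\<close>.\<close>
  ultimately show thesis
    using nuclear_norm_psd_isometry[OF Npsd ND U V]
      nuclear_norm_psd_isometry[OF diag_matrix_psd[of d, OF d0] dDD U V] XD c(1) that by metis
qed

section \<open>Nonemptiness of the block sets and the zero element of \<open>W_set\<close>\<close>

lemma stiefel_nonempty:
  assumes "q \<le> m"
  shows "stiefel m q \<noteq> {}"
proof -
  \<comment> \<open>The first \<open>q\<close> columns of the identity of size
    \<open>m\<close>.\<close>
  define R where "R = Matrix.mat m q (\<lambda>(i, j). if i = j then 1 else (0::real))"
  have "transpose_mat R * R = 1\<^sub>m q"
  proof (rule eq_matI)
    fix i j assume "i < dim_row (1\<^sub>m q :: real Matrix.mat)" "j < dim_col (1\<^sub>m q :: real Matrix.mat)"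
    then have ij: "i < q" "j < q"
      by simp_all
    have "(transpose_mat R * R) $$ (i, j) = (\<Sum>k=0..<m. (if k = i then 1 else 0) * (if k = j then 1 else 0))"
      using ij by (simp add: R_def scalar_prod_def)
    also have "\<dots> = (\<Sum>k=0..<m. if k = i then (if i = j then 1 else 0) else 0)"
      by (intro sum.cong) auto
    also have "\<dots> = 1\<^sub>m q $$ (i, j)"
      using ij assms by simp
    finally show "(transpose_mat R * R) $$ (i, j) = 1\<^sub>m q $$ (i, j)" .
  qed (simp_all add: R_def)
  then have "R \<in> stiefel m q"
    by (simp add: stiefel_def R_def)
  then show ?thesis by blast
qed

text \<open>The identity block works: padded by zeros it is the diagonal projection onto the first
  \<open>r\<close> coordinates, which for \<open>r = 0\<close> is the zero matrix.\<close>

lemma pd_block_mats_nonempty: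
  assumes r: "r \<le> CARD('n)"
  shows "(pd_block_mats r :: (real^'n::{finite,linorder}^'n::{finite,linorder}) set) \<noteq> {}"
proof -
  define S where "S = (to_hma (four_block_mat (1\<^sub>m r) (0\<^sub>m r (CARD('n) - r))
    (0\<^sub>m (CARD('n) - r) r) (0\<^sub>m (CARD('n) - r) (CARD('n) - r))) :: real^'n::{finite,linorder}^'n::{finite,linorder})"
  have "pos i - r < CARD('n) - r" if "\<not> pos i < r" for i :: 'n
    using that pos_less_card[of i] by linarith
  then have "S = diag_matrix (\<lambda>i. if pos i < r then 1 else 0)"
    using r pos_less_card[where 'a='n]
    by (auto simp: S_def Finite_Cartesian_Product.vec_eq_iff to_hma_def diag_matrix_nth inj_eq[OF inj_pos])
  then have "S \<in> psd_mats"
    by (simp add: diag_matrix_psd)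
  moreover have "1\<^sub>m r \<in> pd_mats r"
  proof -
    have "0 < scalar_prod x (1\<^sub>m r *\<^sub>v x)" if x: "x \<in> carrier_vec r" "x \<noteq> 0\<^sub>v r" for x :: "real Matrix.vec"
    proof -
      obtain i where "i < r" "vec_index x i \<noteq> 0"
        using x by (metis carrier_vecD eq_vecI index_zero_vec)
      then have "0 < (\<Sum>i=0..<r. vec_index x i * vec_index x i)"
        by (intro sum_pos2[of _ i]) (auto simp: zero_less_mult_iff)
      then show ?thesis
        using x by (simp add: scalar_prod_def)
    qed
    then show ?thesis
      by (simp add: pd_mats_def)
  qed
  ultimately have "S \<in> pd_block_mats r"
    unfolding pd_block_mats_def S_def by blast
  then show ?thesis by blast
qed

text \<open>Take \<open>M = 0\<close>, written as \<open>S - S\<close> with a padded positive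
  definite block \<open>S\<close>, which is itself positive semidefinite. Any Stiefel matrix of the
  right size serves as \<open>R\<close>; one exists since p \<le> n.\<close>

lemma zero_in_W_set:
  fixes X :: "real^'p::{finite,linorder}^'n::{finite,linorder}"
  assumes "CARD('p) \<le> CARD('n)"
  shows "0 \<in> W_set U V X"
proof -
  have r: "rank X \<le> CARD('n)"
    using rank_bound[of X] by simp
  obtain R where R: "R \<in> stiefel (CARD('n) - rank X) (CARD('p) - rank X)"
    using stiefel_nonempty[of "CARD('p) - rank X" "CARD('n) - rank X"] assms by (meson diff_le_mono ex_in_conv)
  obtain S :: "real^'n::{finite,linorder}^'n::{finite,linorder}" where S: "S \<in> pd_block_mats (rank X)"
    using pd_block_mats_nonempty[OF r] by blast
  then have "S \<in> psd_mats"
    by (simp add: pd_block_mats_def)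
  with S have "(0 :: real^'n::{finite,linorder}^'n::{finite,linorder}) \<in> {P - S |P S. P \<in> psd_mats \<and> S \<in> pd_block_mats (rank X)}"
    unfolding mem_Collect_eq by (metis diff_self)
  moreover have "trace (0 :: real^'n::{finite,linorder}^'n::{finite,linorder}) = 0"
    by (simp add: trace_def)
  ultimately show ?thesis
    unfolding W_set_def using R
    by (intro CollectI exI[of _ 0] exI[of _ R]) simp
qed

section \<open>Relative interior and parallel subspace\<close>

text \<open>From a relative interior point \<open>a\<close> one can move slightly beyond
  \<open>a\<close>, away from \<open>y\<close>, without leaving \<open>C\<close>. If
  \<open>y\<close> had a strictly smaller inner product with \<open>z\<close>, this move would
  exceed the maximum at \<open>a\<close>.\<close>

lemma rel_interior_maximizer_inner:
  assumes a: "a \<in> rel_interior C" and le: "\<And>y. y \<in> C \<Longrightarrow> y \<bullet> z \<le> a \<bullet> z" and y: "y \<in> C"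
  shows "y \<bullet> z = a \<bullet> z"
proof (rule antisym[OF le[OF y]])
  obtain e where aC: "a \<in> C" and e: "0 < e" "ball a e \<inter> affine hull C \<subseteq> C"
    using a by (auto simp: mem_rel_interior_ball)
  define k where "k = norm (a - y) + 1"
  \<comment> \<open>With this step length \<open>w\<close> lies within \<open>e / 2\<close> of
    \<open>a\<close>. The summand 1 in \<open>k\<close> avoids division by zero when
    \<open>y = a\<close>.\<close>
  define t where "t = e / (2 * k)"
  have k: "0 < k"
    by (simp add: k_def add_nonneg_pos)
  then have t: "0 < t"
    using e(1) by (simp add: t_def)
  define w where "w = (1 + t) *\<^sub>R a + (- t) *\<^sub>R y"
  have "w - a = t *\<^sub>R (a - y)"
    by (simp add: w_def algebra_simps)
  then have "dist a w = t * norm (a - y)"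
    using t by (metis abs_of_pos dist_commute dist_norm norm_scaleR)
  also have "\<dots> \<le> t * k"
    using t by (simp add: k_def)
  also have "\<dots> = e / 2"
    using k by (simp add: t_def)
  also have "\<dots> < e"
    using e(1) by simp
  finally have "w \<in> ball a e"
    by simp
  moreover have "w \<in> affine hull C"
    unfolding w_def by (intro mem_affine affine_affine_hull hull_inc aC y) simp
  ultimately have "w \<bullet> z \<le> a \<bullet> z"
    using e(2) le by blast
  then have "t * (a \<bullet> z) \<le> t * (y \<bullet> z)"
    by (simp add: w_def inner_add_left algebra_simps)
  then show "a \<bullet> z \<le> y \<bullet> z"
    using t by simp
qed

text \<open>A hyperplane containing \<open>C\<close> contains its affine hull, so differences of
  points of the hull are orthogonal to the normal \<open>z\<close>.\<close>

lemma par_inner_eq_0: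
  assumes "\<And>y. y \<in> C \<Longrightarrow> y \<bullet> z = c" and "v \<in> par C"
  shows "v \<bullet> z = 0"
proof -
  have "affine hull C \<subseteq> {y. z \<bullet> y = c}"
    using assms(1) by (intro hull_minimal affine_hyperplane) (auto simp: inner_commute)
  then show ?thesis
    using assms by (auto simp: par_def inner_diff_left inner_diff_right inner_commute[of z])
qed

section \<open>Orthogonality of a kernel direction to the whole space\<close>

theorem proposition4p7:
  fixes A :: "real^'p::{finite,linorder}^'n::{finite,linorder} \<Rightarrow> 'e::euclidean_space"
    and b :: 'e
    and X :: "real^'p::{finite,linorder}^'n::{finite,linorder}"
    and U :: "real^'n::{finite,linorder}^'n::{finite,linorder}"
    and V :: "real^'p::{finite,linorder}^'p::{finite,linorder}"
  assumes "CARD('p) \<le> CARD('n)"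
    and "linear A"
    and "A X = b"
    and "orthogonal_matrix U"
    and "orthogonal_matrix V"
    and "X = U ** rect_diag (singular_values X) ** transpose V"
    and "rel_interior (subdifferential nuclear_norm X) \<inter> range (adjoint A) \<noteq> {}"
    and "par (subdifferential nuclear_norm X) + range (adjoint A) = UNIV"
  shows "{Z. A Z = 0} \<inter> W_set U V X = {0}"
proof -
  let ?C = "subdifferential nuclear_norm X"
  have "Z = 0" if AZ: "A Z = 0" and ZW: "Z \<in> W_set U V X" for Z
  proof -
    \<comment> \<open>The kernel of \<open>A\<close> is orthogonal to the range of its
      adjoint.\<close>
    have range_orth: "y \<bullet> Z = 0" if "y \<in> range (adjoint A)" for y
      using that adjoint_clauses(2)[OF assms(2)] AZ by auto
    obtain c where c: "0 < c" "nuclear_norm (X + c *\<^sub>R Z) = nuclear_norm X"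
      using nuclear_norm_constant_along_W[OF assms(1,4,5,6) ZW] by blast
    have le: "y \<bullet> Z \<le> 0" if "y \<in> ?C" for y
    proof -
      have "nuclear_norm X + y \<bullet> (X + c *\<^sub>R Z - X) \<le> nuclear_norm (X + c *\<^sub>R Z)"
        using that unfolding subdifferential_def by blast
      then show ?thesis
        using c by (simp add: mult_le_0_iff)
    qed
    obtain a where a: "a \<in> rel_interior ?C" "a \<in> range (adjoint A)"
      using assms(7) by blast
    \<comment> \<open>The point \<open>a\<close> has inner product 0 with \<open>Z\<close>, the
      largest value permitted by \<open>le\<close>, so it is a maximizer in the relative
      interior.\<close>
    have "y \<bullet> Z = 0" if "y \<in> ?C" for y
      using rel_interior_maximizer_inner[OF a(1) _ that, of Z] le range_orth[OF a(2)] by simp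
    then have par_orth: "v \<bullet> Z = 0" if "v \<in> par ?C" for v
      using par_inner_eq_0 that by blast
    have "Z \<in> par ?C + range (adjoint A)"
      using assms(8) by simp
    then obtain v y where "Z = v + y" "v \<in> par ?C" "y \<in> range (adjoint A)"
      by (auto simp: set_plus_def)
    then have "Z \<bullet> Z = 0"
      using par_orth[of v] range_orth[of y] by (metis add_0 inner_add_left)
    then show "Z = 0"
      by simp
  qed
  moreover have "A 0 = 0"
    by (rule linear_0[OF assms(2)])
  ultimately show ?thesis
    using zero_in_W_set[OF assms(1)] by auto
qed

end
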